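(* Let $q$ be a prime power and for $n \geq 1$ let $e_n$ be the number of $n \times n$ linear derangements over $\mathbf{F}_q$. Then $$1 + \sum_{n \geq 1} \frac{e_n}{\gamma_n}u^n = \frac{1}{1-u} \prod_{r \geq 1}\left(1-\frac{u}{q^r} \right).$$
   Context: $\mathbf{F}_q$ is the field with $q$ elements. $\gamma_n=\gamma_n(q)=|\mathrm{GL}_n(q)|=(q^n-1)(q^n-q)\cdots(q^n-q^{n-1})$ is the order of the group of invertible $n\times n$ matrices over $\mathbf{F}_q$, with $\gamma_0=1$. A square matrix over $\mathbf{F}_q$ is a linear derangement if it is invertible and fixes no non-zero vector (equivalently, neither $0$ nor $1$ is an eigenvalue). The identity is one of formal power series in $u$ with real coefficients, the infinite product being taken as a coefficientwise limit. *)

theory Defs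
  imports
    "Jordan_Normal_Form.Matrix"
    "HOL-Computational_Algebra.Formal_Power_Series"
    "HOL-Library.Cardinality"
begin

definition GL_mats :: "nat \<Rightarrow> 'a :: field mat set" where
  "GL_mats n = {A \<in> carrier_mat n n. invertible_mat A}"

definition linear_derangement :: "nat \<Rightarrow> 'a :: field mat \<Rightarrow> bool" where
  "linear_derangement n A \<longleftrightarrow>
     A \<in> carrier_mat n n \<and> invertible_mat A \<and>
     (\<forall>v \<in> carrier_vec n. v \<noteq> 0\<^sub>v n \<longrightarrow> A *\<^sub>v v \<noteq> v)"

text \<open>
  Infinite products over \<open>r \<ge> 1\<close> as coefficientwise limits, with respect to the usual topology
  of the reals. The library's own topology on formal power series is the \<open>X\<close>-adic one, in which
  products such as \<open>\<Prod>r\<ge>1. 1 - u / q ^ r\<close> do not converge (their coefficients do not stabilise).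
\<close>

definition fps_convergent_prod :: "(nat \<Rightarrow> real fps) \<Rightarrow> bool" where
  "fps_convergent_prod f \<longleftrightarrow> (\<forall>k. convergent (\<lambda>N. fps_nth (\<Prod>r = 1..N. f r) k))"

text \<open>Meaningful only if \<open>fps_convergent_prod f\<close> holds.\<close>

definition fps_prodinf :: "(nat \<Rightarrow> real fps) \<Rightarrow> real fps" where
  "fps_prodinf f = Abs_fps (\<lambda>k. lim (\<lambda>N. fps_nth (\<Prod>r = 1..N. f r) k))"

end

theory Submission
  imports Defs "Jordan_Normal_Form.Determinant" "Berlekamp_Zassenhaus.Berlekamp_Type_Based"
begin

text \<open>
  Write \<open>q\<close> for the order of the field and \<open>G\<close> for the general linear group. The proof is the method
  of moments applied to the size \<open>Q(A)\<close> of the fixed space of a random \<open>A \<in> G\<close>.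

  For \<open>m \<le> n\<close> the group \<open>G\<close> acts transitively on the linearly independent lists of \<open>m\<close> vectors,
  because each such list extends to a basis. By Burnside's lemma the number of lists fixed by \<open>A\<close>
  sums to \<open>|G|\<close> over all \<open>A \<in> G\<close> (\<open>sum_fixed_indep_lists\<close>). A list is fixed by \<open>A\<close> exactly when
  its entries lie in the fixed space, and choosing the entries one after the other shows that there
  are \<open>\<Prod>i<m. Q(A) - q ^ i\<close> such lists (\<open>card_indep_lists\<close>). So all the moments
  \<open>\<Prod>i<m. Q(A) - q ^ i\<close> with \<open>m \<le> n\<close> have mean \<open>1\<close>.

  The invertible matrix \<open>A\<close> is a derangement iff \<open>Q(A) = 1\<close>, and on the possible values
  \<open>1, q, ..., q ^ n\<close> of \<open>Q\<close> the indicator of \<open>Q = 1\<close> is the linear combination of these moments with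
  coefficients \<open>c m = (-1) ^ m / (\<Prod>i=1..m. q ^ i - 1)\<close>
  (\<open>q_alternating_sum_indicator\<close>). Hence the proportion of derangements in \<open>G\<close> is
  \<open>\<Sum>m\<le>n. c m\<close> (\<open>card_linear_derangements\<close>).

  Multiplying by \<open>1 / (1 - u)\<close> takes partial sums of coefficients, so it remains to see that \<open>c k\<close> is
  the coefficient of \<open>u ^ k\<close> in the infinite product, which is Euler's expansion. It follows
  (\<open>euler_prod_coeff_tendsto\<close>) from the functional equation relating the values at \<open>q u\<close> and at \<open>u\<close>
  of consecutive partial products.
\<close>

section \<open>Independent lists of vectors\<close>

text \<open>
  Spans and independence are defined by recursion on lists rather than through the linear
  combinations over sets of the vector space locales: in this form the number of independent lists is
  a one-step induction.
\<close>

fun list_span :: "nat \<Rightarrow> 'a::field vec list \<Rightarrow> 'a vec set" where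
  "list_span n [] = {0\<^sub>v n}"
| "list_span n (v # vs) = {c \<cdot>\<^sub>v v + w | c w. w \<in> list_span n vs}"

fun indep_list :: "nat \<Rightarrow> 'a::field vec list \<Rightarrow> bool" where
  "indep_list n [] \<longleftrightarrow> True"
| "indep_list n (v # vs) \<longleftrightarrow> indep_list n vs \<and> v \<notin> list_span n vs"

text \<open>
  A single closure condition, under \<open>c \<cdot>\<^sub>v v + w\<close>, has the shape of the recursion for spans.
\<close>

definition is_subspace :: "nat \<Rightarrow> 'a::field vec set \<Rightarrow> bool" where
  "is_subspace n W \<longleftrightarrow> W \<subseteq> carrier_vec n \<and> 0\<^sub>v n \<in> W \<and>
     (\<forall>c. \<forall>v\<in>W. \<forall>w\<in>W. c \<cdot>\<^sub>v v + w \<in> W)"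

lemma is_subspace_carrier: "is_subspace n (carrier_vec n)"
  by (auto simp: is_subspace_def)

lemma list_span_subset:
  assumes "is_subspace n W" "set vs \<subseteq> W"
  shows "list_span n vs \<subseteq> W"
  using assms(2)
proof (induction vs)
  case Nil
  then show ?case using assms(1) by (auto simp: is_subspace_def)
next
  case (Cons v vs)
  then show ?case using assms(1) by (auto simp: is_subspace_def)
qed

lemma is_subspace_list_span:
  assumes "set vs \<subseteq> carrier_vec n"
  shows "is_subspace n (list_span n vs)"
  using assms
proof (induction vs)
  case Nil
  then show ?case by (auto simp: is_subspace_def)
next
  case (Cons v vs)
  let ?S = "list_span n vs"
  have v: "v \<in> carrier_vec n" and S: "is_subspace n ?S"
    using Cons by auto
  have sub: "?S \<subseteq> carrier_vec n" and zero: "0\<^sub>v n \<in> ?S"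
    and closed: "\<And>c x y. x \<in> ?S \<Longrightarrow> y \<in> ?S \<Longrightarrow> c \<cdot>\<^sub>v x + y \<in> ?S"
    using S by (auto simp: is_subspace_def)
  show ?case
    unfolding is_subspace_def
  proof (intro conjI allI ballI)
    show "list_span n (v # vs) \<subseteq> carrier_vec n"
      using sub v by auto
    have "0\<^sub>v n = 0 \<cdot>\<^sub>v v + 0\<^sub>v n"
      using v by auto
    then show "0\<^sub>v n \<in> list_span n (v # vs)"
      using zero by auto
  next
    fix c x y
    assume "x \<in> list_span n (v # vs)" "y \<in> list_span n (v # vs)"
    then obtain a b x' y' where x: "x = a \<cdot>\<^sub>v v + x'" "x' \<in> ?S" and y: "y = b \<cdot>\<^sub>v v + y'" "y' \<in> ?S"
      by auto
    have "x' \<in> carrier_vec n" "y' \<in> carrier_vec n" using sub x y by auto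
    then have "c \<cdot>\<^sub>v x + y = (c * a + b) \<cdot>\<^sub>v v + (c \<cdot>\<^sub>v x' + y')"
      unfolding x(1) y(1) using v by (intro eq_vecI) (simp_all add: algebra_simps)
    then show "c \<cdot>\<^sub>v x + y \<in> list_span n (v # vs)"
      using closed[OF x(2) y(2)] by auto
  qed
qed

lemma finite_list_span:
  fixes vs :: "'a::{field,finite} vec list"
  assumes "set vs \<subseteq> carrier_vec n"
  shows "finite (list_span n vs)"
  using list_span_subset[OF is_subspace_carrier assms] finite_carrier_vec finite_subset by blast

text \<open>
  By independence each vector of the span of \<open>v # vs\<close> is \<open>c \<cdot>\<^sub>v v + w\<close> for only one pair \<open>(c, w)\<close>:
  two pairs with different \<open>c\<close> would express \<open>v\<close> through \<open>vs\<close>.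
\<close>

lemma card_list_span:
  fixes vs :: "'a::{field,finite} vec list"
  assumes "set vs \<subseteq> carrier_vec n" "indep_list n vs"
  shows "card (list_span n vs) = CARD('a) ^ length vs"
  using assms
proof (induction vs)
  case Nil
  then show ?case by simp
next
  case (Cons v vs)
  let ?S = "list_span n vs"
  let ?f = "\<lambda>(c, w). c \<cdot>\<^sub>v v + w"
  have v: "v \<in> carrier_vec n" and vs: "set vs \<subseteq> carrier_vec n" and nv: "v \<notin> ?S"
    using Cons by auto
  have S: "is_subspace n ?S" by (rule is_subspace_list_span[OF vs])
  have sub: "?S \<subseteq> carrier_vec n" and zero: "0\<^sub>v n \<in> ?S"
    and closed: "\<And>c x y. x \<in> ?S \<Longrightarrow> y \<in> ?S \<Longrightarrow> c \<cdot>\<^sub>v x + y \<in> ?S"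
    using S by (auto simp: is_subspace_def)
  have "inj_on ?f (UNIV \<times> ?S)"
  proof (rule inj_onI, clarify)
    fix a x b y
    assume xy: "x \<in> ?S" "y \<in> ?S" and eq: "a \<cdot>\<^sub>v v + x = b \<cdot>\<^sub>v v + y"
    have x: "x \<in> carrier_vec n" and y: "y \<in> carrier_vec n" using sub xy by auto
    have eqi: "a * v $ i + x $ i = b * v $ i + y $ i" if "i < n" for i
      using arg_cong[OF eq, of "\<lambda>u. u $ i"] that v x y by auto
    have ab: "a = b"
    proof (rule ccontr)
      assume "a \<noteq> b"
      then have nz: "a - b \<noteq> 0" by simp
      let ?d = "1 / (a - b)"
      have "v = ?d \<cdot>\<^sub>v ((-1) \<cdot>\<^sub>v x + y) + 0\<^sub>v n"
      proof (rule eq_vecI)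
        fix i assume "i < dim_vec (?d \<cdot>\<^sub>v ((-1) \<cdot>\<^sub>v x + y) + 0\<^sub>v n)"
        then have i: "i < n" using y by auto
        have "(a - b) * v $ i = y $ i - x $ i"
          using eqi[OF i] by (simp add: algebra_simps)
        then have "v $ i = ?d * (y $ i - x $ i)"
          using nz by (simp add: field_simps)
        then show "v $ i = (?d \<cdot>\<^sub>v ((-1) \<cdot>\<^sub>v x + y) + 0\<^sub>v n) $ i"
          using i x y by simp
      qed (use v y in auto)
      then have "v \<in> ?S"
        using closed[OF closed[OF xy] zero] by metis
      then show False using nv by simp
    qed
    moreover have "x = y"
      using eqi ab x y by (intro eq_vecI) auto
    ultimately show "a = b \<and> x = y" by simp
  qed
  moreover have "list_span n (v # vs) = ?f ` (UNIV \<times> ?S)"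
    by auto
  ultimately have "card (list_span n (v # vs)) = CARD('a) * card ?S"
    by (simp add: card_image card_cartesian_product)
  then show ?case using Cons by simp
qed

definition indep_lists :: "nat \<Rightarrow> 'a::field vec set \<Rightarrow> nat \<Rightarrow> 'a vec list set" where
  "indep_lists n W m = {vs. set vs \<subseteq> W \<and> length vs = m \<and> indep_list n vs}"

lemma indep_lists_0: "indep_lists n W 0 = {[]}"
  by (auto simp: indep_lists_def)

lemma indep_lists_Suc:
  "indep_lists n W (Suc m) =
    (\<lambda>(vs, v). v # vs) ` (SIGMA vs : indep_lists n W m. W - list_span n vs)"
  by (force simp: indep_lists_def length_Suc_conv image_iff)

lemma finite_indep_lists: "finite W \<Longrightarrow> finite (indep_lists n W m)"
  by (rule finite_subset[OF _ finite_lists_length_eq[of W m]]) (auto simp: indep_lists_def)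

text \<open>
  An independent list of length \<open>m\<close> can be prolonged by any of the vectors of \<open>W\<close> outside its span,
  which has \<open>q ^ m\<close> elements. Once \<open>m\<close> exceeds the dimension of \<open>W\<close> there are no such lists, and
  the product contains the factor \<open>0\<close>.
\<close>

lemma card_indep_lists:
  fixes W :: "'a::{field,finite} vec set"
  assumes W: "is_subspace n W"
  shows "real (card (indep_lists n W m)) = (\<Prod>i<m. real (card W) - real CARD('a) ^ i)"
proof (induction m)
  case 0
  then show ?case by (simp add: indep_lists_0)
next
  case (Suc m)
  have Wc: "W \<subseteq> carrier_vec n" using W by (simp add: is_subspace_def)
  then have finW: "finite W" using finite_carrier_vec finite_subset by blast
  have "real (card (indep_lists n W (Suc m)))
      = real (card (SIGMA vs : indep_lists n W m. W - list_span n vs))"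
    unfolding indep_lists_Suc by (subst card_image) (auto simp: inj_on_def)
  also have "\<dots> = (\<Sum>vs \<in> indep_lists n W m. real (card (W - list_span n vs)))"
    using finW by (simp add: card_SigmaI finite_indep_lists)
  also have "\<dots> = (\<Sum>vs \<in> indep_lists n W m. real (card W) - real CARD('a) ^ m)"
  proof (rule sum.cong[OF refl])
    fix vs assume "vs \<in> indep_lists n W m"
    then have vs: "set vs \<subseteq> W" "length vs = m" "indep_list n vs"
      by (auto simp: indep_lists_def)
    have sub: "list_span n vs \<subseteq> W" by (rule list_span_subset[OF W vs(1)])
    have "card (list_span n vs) = CARD('a) ^ m"
      using card_list_span[of vs n] vs Wc by auto
    moreover have "real (card (W - list_span n vs)) = real (card W) - real (card (list_span n vs))"
      using sub finW by (simp add: card_Diff_subset finite_subset card_mono of_nat_diff)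
    ultimately show "real (card (W - list_span n vs)) = real (card W) - real CARD('a) ^ m"
      by simp
  qed
  also have "\<dots> = real (card (indep_lists n W m)) * (real (card W) - real CARD('a) ^ m)"
    by simp
  finally show ?case using Suc by simp
qed

lemma two_le_card_field: "2 \<le> CARD('a::{field,finite})"
proof -
  have "card {0, 1 :: 'a} \<le> CARD('a)" by (rule card_mono) auto
  then show ?thesis by simp
qed

text \<open>
  No dimension theory is involved: \<open>W\<close> is too small to contain an independent list of length
  \<open>Suc n\<close>, so the product that counts these lists has a vanishing factor, which says that \<open>card W\<close>
  is a power of \<open>q\<close>.
\<close>

lemma card_subspace:
  fixes W :: "'a::{field,finite} vec set"
  assumes W: "is_subspace n W"
  obtains d where "d \<le> n" "card W = CARD('a) ^ d"
proof -
  let ?q = "CARD('a)"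
  have q: "2 \<le> ?q" by (rule two_le_card_field)
  have Wc: "W \<subseteq> carrier_vec n" using W by (simp add: is_subspace_def)
  then have finW: "finite W" using finite_carrier_vec finite_subset by blast
  have card_le: "card W \<le> ?q ^ n"
    using card_mono[OF _ Wc] by (simp add: card_carrier_vec)
  have "card W < ?q ^ Suc n"
    using card_le power_strict_increasing[of n "Suc n" ?q] q by linarith
  have "indep_lists n W (Suc n) = {}"
  proof (rule ccontr)
    assume "indep_lists n W (Suc n) \<noteq> {}"
    then obtain vs where vs: "set vs \<subseteq> W" "length vs = Suc n" "indep_list n vs"
      by (auto simp: indep_lists_def)
    have "card (list_span n vs) = ?q ^ Suc n"
      using card_list_span[of vs n] vs Wc by auto
    moreover have "card (list_span n vs) \<le> card W"
      by (rule card_mono[OF finW list_span_subset[OF W vs(1)]])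
    ultimately show False using \<open>card W < ?q ^ Suc n\<close> by simp
  qed
  then have "(\<Prod>i<Suc n. real (card W) - real ?q ^ i) = 0"
    using card_indep_lists[OF W, of "Suc n"] by simp
  then obtain d where "d < Suc n" "real (card W) = real ?q ^ d"
    by (auto simp: prod_zero_iff simp del: prod.lessThan_Suc)
  then show ?thesis
    using that[of d] by (metis less_Suc_eq_le of_nat_eq_iff of_nat_power)
qed

text \<open>
  A list shorter than \<open>n\<close> has a span with fewer than \<open>q ^ n\<close> elements, which leaves room for another
  vector.
\<close>

lemma indep_list_extend:
  fixes vs :: "'a::{field,finite} vec list"
  assumes "set vs \<subseteq> carrier_vec n" "indep_list n vs" "length vs \<le> n"
  obtains us where "set us \<subseteq> carrier_vec n" "indep_list n (us @ vs)" "length (us @ vs) = n"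
proof -
  have "\<exists>us. set us \<subseteq> carrier_vec n \<and> indep_list n (us @ vs) \<and> length (us @ vs) = length vs + k"
    if "length vs + k \<le> n" for k
    using that
  proof (induction k)
    case 0
    then show ?case using assms by (intro exI[of _ "[]"]) simp
  next
    case (Suc k)
    then obtain us where us: "set us \<subseteq> carrier_vec n" "indep_list n (us @ vs)"
      "length (us @ vs) = length vs + k" by auto
    have "card (list_span n (us @ vs)) = CARD('a) ^ (length vs + k)"
      using card_list_span[of "us @ vs" n] us assms by (simp add: add.commute)
    also have "\<dots> < CARD('a) ^ n"
      using Suc.prems two_le_card_field[where 'a='a] by (intro power_strict_increasing) auto
    also have "\<dots> = card (carrier_vec n :: 'a vec set)"
      by (simp add: card_carrier_vec)
    finally have "card (list_span n (us @ vs)) < card (carrier_vec n :: 'a vec set)" .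
    then have "\<not> carrier_vec n \<subseteq> list_span n (us @ vs)"
      using us(1) assms(1) card_mono[OF finite_list_span[of "us @ vs" n], of "carrier_vec n"] by auto
    then obtain v where "v \<in> carrier_vec n" "v \<notin> list_span n (us @ vs)" by blast
    then show ?case using us by (intro exI[of _ "v # us"]) auto
  qed
  from this[of "n - length vs"] show ?thesis using that assms(3) by auto
qed

section \<open>The general linear group acting on independent lists\<close>

lemma list_span_subset_range:
  assumes "set vs \<subseteq> carrier_vec n" "w \<in> list_span n vs"
  obtains c where "c \<in> carrier_vec (length vs)" "w = mat_of_cols n vs *\<^sub>v c"
proof -
  have "\<exists>c \<in> carrier_vec (length vs). w = mat_of_cols n vs *\<^sub>v c"
    using assms
  proof (induction vs arbitrary: w)
    case Nil
    then show ?case by (intro bexI[of _ "vNil"]) (auto simp: mat_of_cols_def scalar_prod_def)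
  next
    case (Cons v vs)
    then obtain a w' where w: "w = a \<cdot>\<^sub>v v + w'" "w' \<in> list_span n vs" by auto
    then obtain c where c: "c \<in> carrier_vec (length vs)" "w' = mat_of_cols n vs *\<^sub>v c"
      using Cons by auto
    have v: "v \<in> carrier_vec n" using Cons by auto
    have "w = mat_of_cols n (v # vs) *\<^sub>v vCons a c"
    proof (rule eq_vecI)
      fix i assume "i < dim_vec (mat_of_cols n (v # vs) *\<^sub>v vCons a c)"
      then have i: "i < n" by simp
      have "row (mat_of_cols n (v # vs)) i = vCons (v $ i) (row (mat_of_cols n vs) i)"
        using i by (intro eq_vecI)
          (auto simp: mat_of_cols_index vec_index_vCons nth_Cons split: nat.splits)
      then show "w $ i = (mat_of_cols n (v # vs) *\<^sub>v vCons a c) $ i"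
        using i v c w by (simp add: mult.commute)
    qed (use v c w in auto)
    then show ?case using c by (intro bexI[of _ "vCons a c"]) auto
  qed
  then show ?thesis using that by blast
qed

lemma GL_matsI:
  assumes "A \<in> carrier_mat n n" "B \<in> carrier_mat n n" "A * B = 1\<^sub>m n"
  shows "A \<in> GL_mats n"
  using assms mat_mult_left_right_inverse[OF assms]
  by (auto simp: GL_mats_def invertible_mat_def inverts_mat_def)

lemma GL_matsE:
  assumes "A \<in> GL_mats n"
  obtains B where "A \<in> carrier_mat n n" "B \<in> GL_mats n" "B \<in> carrier_mat n n"
    "A * B = 1\<^sub>m n" "B * A = 1\<^sub>m n"
proof -
  have A: "A \<in> carrier_mat n n" using assms by (simp add: GL_mats_def)
  obtain B where B: "A * B = 1\<^sub>m n" "B * A = 1\<^sub>m (dim_row B)"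
    using assms A by (auto simp: GL_mats_def invertible_mat_def inverts_mat_def)
  have "dim_row B = n" using arg_cong[OF B(2), of dim_col] A by simp
  moreover have "dim_col B = n" using arg_cong[OF B(1), of dim_col] by simp
  ultimately have Bc: "B \<in> carrier_mat n n" "B * A = 1\<^sub>m n" using B by auto
  show ?thesis using that[OF A GL_matsI[OF Bc(1) A Bc(2)] Bc(1) B(1) Bc(2)] .
qed

lemma GL_mats_mult:
  assumes "A \<in> GL_mats n" "B \<in> GL_mats n"
  shows "A * B \<in> GL_mats n"
proof -
  obtain A' where A: "A \<in> carrier_mat n n" "A' \<in> carrier_mat n n" "A * A' = 1\<^sub>m n"
    using GL_matsE[OF assms(1)] by metis
  obtain B' where B: "B \<in> carrier_mat n n" "B' \<in> carrier_mat n n" "B * B' = 1\<^sub>m n"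
    using GL_matsE[OF assms(2)] by metis
  have "(A * B) * (B' * A') = A * (B * (B' * A'))"
    using A B by (intro assoc_mult_mat) auto
  also have "B * (B' * A') = (B * B') * A'"
    using A B by (intro assoc_mult_mat[symmetric]) auto
  also have "A * (B * B' * A') = 1\<^sub>m n" using A B by (simp only: left_mult_one_mat)
  finally show ?thesis
    using A B by (intro GL_matsI[of "A * B" n "B' * A'"]) auto
qed

lemma finite_GL_mats: "finite (GL_mats n :: 'a::{field,finite} mat set)"
proof (rule finite_subset)
  show "GL_mats n \<subseteq> mat_of_cols n ` {vs. set vs \<subseteq> (carrier_vec n :: 'a vec set) \<and> length vs = n}"
  proof
    fix A :: "'a mat" assume "A \<in> GL_mats n"
    then have A: "A \<in> carrier_mat n n" by (simp add: GL_mats_def)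
    then have "A = mat_of_cols n (cols A)" by (metis carrier_matD(1) mat_of_cols_cols)
    moreover have "set (cols A) \<subseteq> carrier_vec n" "length (cols A) = n"
      using A cols_dim[of A] by auto
    ultimately show "A \<in> mat_of_cols n ` {vs. set vs \<subseteq> carrier_vec n \<and> length vs = n}"
      by blast
  qed
qed (simp add: finite_lists_length_eq)

lemma GL_mats_cancel:
  assumes "A \<in> GL_mats n" "v \<in> carrier_vec n" "w \<in> carrier_vec n" "A *\<^sub>v v = A *\<^sub>v w"
  shows "v = w"
proof -
  obtain B where B: "A \<in> carrier_mat n n" "B \<in> carrier_mat n n" "B * A = 1\<^sub>m n"
    using GL_matsE[OF assms(1)] by metis
  have "(B * A) *\<^sub>v v = (B * A) *\<^sub>v w"
    unfolding assoc_mult_mat_vec[OF B(2,1) assms(2)] assoc_mult_mat_vec[OF B(2,1) assms(3)] assms(4) ..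
  then show ?thesis using B(3) assms(2,3) by (simp only: one_mult_mat_vec)
qed

lemma list_span_map:
  assumes A: "A \<in> carrier_mat n n" and vs: "set vs \<subseteq> carrier_vec n"
  shows "list_span n (map ((*\<^sub>v) A) vs) = (*\<^sub>v) A ` list_span n vs"
  using vs
proof (induction vs)
  case Nil
  then show ?case using A by auto
next
  case (Cons v vs)
  have v: "v \<in> carrier_vec n" using Cons by auto
  have sub: "list_span n vs \<subseteq> carrier_vec n"
    using list_span_subset[OF is_subspace_carrier] Cons by auto
  have lin: "A *\<^sub>v (c \<cdot>\<^sub>v v + w) = c \<cdot>\<^sub>v (A *\<^sub>v v) + A *\<^sub>v w" if "w \<in> list_span n vs" for c w
    using A v sub that by (subst mult_add_distrib_mat_vec[of _ n n]) auto
  show ?case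
  proof safe
    fix x assume "x \<in> list_span n (map ((*\<^sub>v) A) (v # vs))"
    then obtain c w where "x = c \<cdot>\<^sub>v (A *\<^sub>v v) + A *\<^sub>v w" "w \<in> list_span n vs"
      using Cons by auto
    then show "x \<in> (*\<^sub>v) A ` list_span n (v # vs)"
      using lin by (intro image_eqI[of _ _ "c \<cdot>\<^sub>v v + w"]) auto
  next
    fix x assume "x \<in> list_span n (v # vs)"
    then obtain c w where "x = c \<cdot>\<^sub>v v + w" "w \<in> list_span n vs" by auto
    then have "A *\<^sub>v x = c \<cdot>\<^sub>v (A *\<^sub>v v) + A *\<^sub>v w"
      and "A *\<^sub>v w \<in> list_span n (map ((*\<^sub>v) A) vs)"
      using Cons lin by auto
    then show "A *\<^sub>v x \<in> list_span n (map ((*\<^sub>v) A) (v # vs))"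
      by auto
  qed
qed

lemma indep_list_map:
  assumes A: "A \<in> GL_mats n" and vs: "set vs \<subseteq> carrier_vec n" "indep_list n vs"
  shows "indep_list n (map ((*\<^sub>v) A) vs)"
  using vs
proof (induction vs)
  case Nil
  then show ?case by simp
next
  case (Cons v vs)
  have sub: "list_span n vs \<subseteq> carrier_vec n"
    using list_span_subset[OF is_subspace_carrier] Cons by auto
  have "A *\<^sub>v v \<notin> (*\<^sub>v) A ` list_span n vs"
    using GL_mats_cancel[OF A, of v] sub Cons by auto
  then show ?case using Cons A by (auto simp: list_span_map GL_mats_def)
qed

lemma map_GL_in_indep_lists:
  assumes "A \<in> GL_mats n" "vs \<in> indep_lists n (carrier_vec n) m"
  shows "map ((*\<^sub>v) A) vs \<in> indep_lists n (carrier_vec n) m"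
  using assms indep_list_map[OF assms(1), of vs]
  by (auto simp: indep_lists_def GL_mats_def)

text \<open>
  The columns span the whole space, so each unit vector has a preimage; the preimages are the columns
  of a right inverse.
\<close>

lemma mat_of_cols_basis_in_GL:
  fixes bs :: "'a::{field,finite} vec list"
  assumes bs: "set bs \<subseteq> carrier_vec n" "indep_list n bs" "length bs = n"
  shows "mat_of_cols n bs \<in> GL_mats n"
proof -
  let ?M = "mat_of_cols n bs"
  have M: "?M \<in> carrier_mat n n" using bs by auto
  have "list_span n bs = carrier_vec n"
    using list_span_subset[OF is_subspace_carrier bs(1)] card_list_span[OF bs(1,2)] bs(3)
    by (intro card_subset_eq) (auto simp: card_carrier_vec)
  then have "\<exists>c. c \<in> carrier_vec n \<and> ?M *\<^sub>v c = unit_vec n j" for j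
    using list_span_subset_range[OF bs(1), of "unit_vec n j"] bs(3) by (metis unit_vec_carrier)
  then obtain c where c: "\<And>j. c j \<in> carrier_vec n" "\<And>j. ?M *\<^sub>v c j = unit_vec n j"
    by metis
  define N where "N = mat_of_cols n (map c [0..<n])"
  have N: "N \<in> carrier_mat n n" by (auto simp: N_def)
  have "?M * N = 1\<^sub>m n"
  proof (rule mat_col_eqI)
    fix j assume "j < dim_col (1\<^sub>m n :: 'a mat)"
    then have j: "j < n" by simp
    have "col (?M * N) j = ?M *\<^sub>v col N j"
      using M N j by (intro col_mult2) auto
    also have "col N j = c j"
      using j c by (simp add: N_def)
    finally show "col (?M * N) j = col (1\<^sub>m n) j"
      using c j by simp
  qed (use M N in auto)
  then show ?thesis by (rule GL_matsI[OF M N])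
qed

text \<open>
  A list \<open>vs\<close> grows to a basis at its front, so it occupies the last \<open>m\<close> columns of the matrix of that
  basis and is the image of the last \<open>m\<close> unit vectors.
\<close>

lemma GL_transitive_unit:
  fixes vs :: "'a::{field,finite} vec list"
  assumes vs: "vs \<in> indep_lists n (carrier_vec n) m" and "m \<le> n"
  obtains A where "A \<in> GL_mats n" "map ((*\<^sub>v) A) (map (unit_vec n) [n - m..<n]) = vs"
proof -
  have v: "set vs \<subseteq> carrier_vec n" "length vs = m" "indep_list n vs"
    using vs by (auto simp: indep_lists_def)
  obtain us where us: "set us \<subseteq> carrier_vec n" "indep_list n (us @ vs)" "length (us @ vs) = n"
    using indep_list_extend[of vs n] v assms(2) by metis
  let ?M = "mat_of_cols n (us @ vs)"
  have M: "?M \<in> GL_mats n"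
    using us v by (intro mat_of_cols_basis_in_GL) auto
  have lus: "length us = n - m" using us(3) v(2) by simp
  have col: "?M *\<^sub>v unit_vec n j = (us @ vs) ! j" if "j < n" for j
  proof -
    have Mc: "?M \<in> carrier_mat n n" using M by (simp add: GL_mats_def)
    have "?M *\<^sub>v unit_vec n j = col ?M j"
      using that col_mult2[OF Mc, of "1\<^sub>m n" n j] right_mult_one_mat[OF Mc] by simp
    then show ?thesis using that us v col_mat_of_cols[of j "us @ vs" n] nth_mem[of j "us @ vs"] by auto
  qed
  have "map ((*\<^sub>v) ?M) (map (unit_vec n) [n - m..<n]) = vs"
    using assms(2) v(2) lus by (intro nth_equalityI) (auto simp: col nth_append)
  then show ?thesis using that M by blast
qed

lemma GL_transitive:
  fixes vs ws :: "'a::{field,finite} vec list"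
  assumes vs: "vs \<in> indep_lists n (carrier_vec n) m"
    and ws: "ws \<in> indep_lists n (carrier_vec n) m" and "m \<le> n"
  obtains A where "A \<in> GL_mats n" "map ((*\<^sub>v) A) vs = ws"
proof -
  let ?E = "map (unit_vec n) [n - m..<n] :: 'a vec list"
  obtain A B where A: "A \<in> GL_mats n" "map ((*\<^sub>v) A) ?E = vs"
    and B: "B \<in> GL_mats n" "map ((*\<^sub>v) B) ?E = ws"
    using GL_transitive_unit[OF vs assms(3)] GL_transitive_unit[OF ws assms(3)] by metis
  obtain A' where A': "A \<in> carrier_mat n n" "A' \<in> GL_mats n" "A' \<in> carrier_mat n n" "A' * A = 1\<^sub>m n"
    using GL_matsE[OF A(1)] by metis
  have Bc: "B \<in> carrier_mat n n" using B by (simp add: GL_mats_def)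
  have "map ((*\<^sub>v) (B * A')) vs = map (\<lambda>x. (B * A') *\<^sub>v (A *\<^sub>v x)) ?E"
    unfolding A(2)[symmetric] by simp
  also have "\<dots> = map ((*\<^sub>v) B) ?E"
  proof (rule map_cong[OF refl])
    fix x assume "x \<in> set ?E"
    then have x: "x \<in> carrier_vec n" by auto
    have "(B * A') *\<^sub>v (A *\<^sub>v x) = B *\<^sub>v (A' *\<^sub>v (A *\<^sub>v x))"
      using A' Bc x by (intro assoc_mult_mat_vec) auto
    also have "A' *\<^sub>v (A *\<^sub>v x) = (A' * A) *\<^sub>v x"
      using A' x by (intro assoc_mult_mat_vec[symmetric]) auto
    finally show "(B * A') *\<^sub>v (A *\<^sub>v x) = B *\<^sub>v x" using A' x by simp
  qed
  finally show ?thesis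
    using that[OF GL_mats_mult[OF B(1) A'(2)]] B(2) by simp
qed

text \<open>
  The matrices taking \<open>vs\<close> to \<open>ws\<close> form a coset of the stabilizer of \<open>ws\<close>: if \<open>G\<close> takes \<open>ws\<close> to \<open>vs\<close>,
  then multiplication by \<open>G\<close> on the right maps the former onto the latter.
\<close>

lemma card_transporter_eq_card_stabilizer:
  fixes vs ws :: "'a::{field,finite} vec list"
  assumes vs: "vs \<in> indep_lists n (carrier_vec n) m"
    and ws: "ws \<in> indep_lists n (carrier_vec n) m" and "m \<le> n"
  shows "card {A \<in> GL_mats n. map ((*\<^sub>v) A) vs = ws} = card {A \<in> GL_mats n. map ((*\<^sub>v) A) ws = ws}"
proof -
  obtain G where G: "G \<in> GL_mats n" "map ((*\<^sub>v) G) ws = vs"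
    using GL_transitive[OF ws vs assms(3)] by metis
  obtain H where H: "G \<in> carrier_mat n n" "H \<in> GL_mats n" "H \<in> carrier_mat n n"
    "G * H = 1\<^sub>m n" "H * G = 1\<^sub>m n" using GL_matsE[OF G(1)] by metis
  have wc: "set ws \<subseteq> carrier_vec n" using ws by (simp add: indep_lists_def)
  have act: "map ((*\<^sub>v) (A * G)) ws = map ((*\<^sub>v) A) vs" if "A \<in> carrier_mat n n" for A
    unfolding G(2)[symmetric] using that H wc
    by (auto simp: assoc_mult_mat_vec[of _ n n _ n] subset_eq)
  have AGH: "A * G * H = A" "A * H * G = A" if "A \<in> carrier_mat n n" for A
    using that H by (simp_all add: assoc_mult_mat[of _ n n _ n _ n])
  have GLc: "A \<in> carrier_mat n n" if "A \<in> GL_mats n" for A :: "'a mat"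
    using that by (simp add: GL_mats_def)
  have "bij_betw (\<lambda>A. A * G) {A \<in> GL_mats n. map ((*\<^sub>v) A) vs = ws}
     {A \<in> GL_mats n. map ((*\<^sub>v) A) ws = ws}"
  proof (rule bij_betw_byWitness[where f' = "\<lambda>A. A * H"])
    show "(\<lambda>A. A * H) ` {A \<in> GL_mats n. map ((*\<^sub>v) A) ws = ws}
        \<subseteq> {A \<in> GL_mats n. map ((*\<^sub>v) A) vs = ws}"
    proof clarify
      fix A assume A: "A \<in> GL_mats n" "map ((*\<^sub>v) A) ws = ws"
      have "map ((*\<^sub>v) (A * H)) vs = map ((*\<^sub>v) (A * H * G)) ws"
        using act[of "A * H"] GLc[OF A(1)] H by simp
      then show "A * H \<in> GL_mats n \<and> map ((*\<^sub>v) (A * H)) vs = ws"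
        using A AGH GLc[OF A(1)] GL_mats_mult[OF A(1) H(2)] by simp
    qed
    show "(\<lambda>A. A * G) ` {A \<in> GL_mats n. map ((*\<^sub>v) A) vs = ws}
        \<subseteq> {A \<in> GL_mats n. map ((*\<^sub>v) A) ws = ws}"
      using act GLc GL_mats_mult[OF _ G(1)] by fastforce
  qed (use AGH GLc in auto)
  then show ?thesis by (rule bij_betw_same_card)
qed

definition fixed_space :: "nat \<Rightarrow> 'a::field mat \<Rightarrow> 'a vec set" where
  "fixed_space n A = {v \<in> carrier_vec n. A *\<^sub>v v = v}"

lemma is_subspace_fixed_space:
  assumes "A \<in> carrier_mat n n"
  shows "is_subspace n (fixed_space n A)"
  using assms
  by (auto simp: is_subspace_def fixed_space_def mult_add_distrib_mat_vec[of A n n] mult_mat_vec[of A n n])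

text \<open>
  This is Burnside's lemma for a transitive action. Counting the pairs of a matrix and a list fixed by
  it in the other order gives the sum of the orders of all stabilizers. Each of them may be replaced
  by the number of matrices that take one chosen list \<open>vs\<close> to the list in question, and every matrix
  takes \<open>vs\<close> to exactly one list.
\<close>

lemma sum_fixed_indep_lists:
  assumes "m \<le> n"
  shows "(\<Sum>A \<in> (GL_mats n :: 'a::{field,finite} mat set). card (indep_lists n (fixed_space n A) m))
    = card (GL_mats n :: 'a mat set)"
proof -
  let ?G = "GL_mats n :: 'a mat set"
  let ?X = "indep_lists n (carrier_vec n) m :: 'a vec list set"
  have finX: "finite ?X" by (rule finite_indep_lists) simp
  have finG: "finite ?G" by (rule finite_GL_mats)
  (* A tail of a basis serves as the chosen list. *)
  obtain vs where vs: "vs \<in> ?X"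
  proof -
    obtain us :: "'a vec list" where us: "set us \<subseteq> carrier_vec n" "indep_list n us" "length us = n"
      using indep_list_extend[of "[]" n] by auto
    have "indep_list n xs \<Longrightarrow> indep_list n (drop k xs)" for k and xs :: "'a vec list"
      by (induction xs arbitrary: k) (auto simp: drop_Cons split: nat.splits)
    then have "drop (n - m) us \<in> ?X"
      using us assms set_drop_subset[of "n - m" us] by (auto simp: indep_lists_def)
    then show ?thesis using that by blast
  qed
  have fixed: "indep_lists n (fixed_space n A) m = {ws \<in> ?X. map ((*\<^sub>v) A) ws = ws}" for A :: "'a mat"
    by (auto simp: indep_lists_def fixed_space_def map_idI subset_eq dest: map_eq_conv[THEN iffD1, of _ _ id, simplified])
  have "(\<Sum>A \<in> ?G. card (indep_lists n (fixed_space n A) m))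
      = (\<Sum>ws \<in> ?X. card {A \<in> ?G. map ((*\<^sub>v) A) ws = ws})"
    unfolding fixed by (rule sum_multicount_gen[OF finG finX]) simp
  also have "\<dots> = (\<Sum>ws \<in> ?X. card {A \<in> ?G. map ((*\<^sub>v) A) vs = ws})"
    using card_transporter_eq_card_stabilizer[OF vs _ assms] by (intro sum.cong) auto
  also have "\<dots> = (\<Sum>A \<in> ?G. card {ws \<in> ?X. map ((*\<^sub>v) A) vs = ws})"
    by (rule sum_multicount_gen[OF finG finX, symmetric]) simp
  also have "\<dots> = (\<Sum>A \<in> ?G. 1)"
  proof (rule sum.cong[OF refl])
    fix A assume "A \<in> ?G"
    then have "{ws \<in> ?X. map ((*\<^sub>v) A) vs = ws} = {map ((*\<^sub>v) A) vs}"
      using map_GL_in_indep_lists[OF _ vs] by blast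
    then show "card {ws \<in> ?X. map ((*\<^sub>v) A) vs = ws} = 1" by simp
  qed
  also have "\<dots> = card ?G" by simp
  finally show ?thesis .
qed

section \<open>Counting linear derangements\<close>

text \<open>
  The sum telescopes. It is a \<open>q\<close>-analogue of
  \<open>(\<Sum>m\<le>n. (-1) ^ m * (x choose m)) = (-1) ^ n * (x - 1 choose n)\<close>, with \<open>Q\<close> in the role of \<open>q ^ x\<close>.
\<close>

lemma q_alternating_sum:
  fixes q Q :: real
  assumes "q > 1"
  shows "(\<Sum>m\<le>n. (-1) ^ m * (\<Prod>i<m. Q - q ^ i) / (\<Prod>i=1..m. q ^ i - 1))
    = (-1) ^ n * (\<Prod>i=1..n. Q - q ^ i) / (\<Prod>i=1..n. q ^ i - 1)"
proof (induction n)
  case 0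
  then show ?case by simp
next
  case (Suc n)
  define P where "P = (\<Prod>i=1..n. q ^ i - 1)"
  define R where "R = (\<Prod>i=1..n. Q - q ^ i)"
  have "q ^ i - 1 \<noteq> 0" if "1 \<le> i" for i
    using one_less_power[OF assms, of i] that by simp
  then have nz: "P \<noteq> 0" "q ^ Suc n - 1 \<noteq> 0"
    by (force simp: P_def prod_zero_iff simp del: power_Suc)+
  have shift: "(\<Prod>i<Suc n. Q - q ^ i) = (Q - 1) * R"
    by (simp add: R_def prod.lessThan_Suc_shift prod.atLeast1_atMost_eq del: prod.lessThan_Suc)
  have P: "(\<Prod>i=1..Suc n. q ^ i - 1) = P * (q ^ Suc n - 1)"
    by (simp add: P_def del: power_Suc)
  have R: "(\<Prod>i=1..Suc n. Q - q ^ i) = R * (Q - q ^ Suc n)"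
    by (simp add: R_def del: power_Suc)
  have "(\<Sum>m\<le>Suc n. (-1) ^ m * (\<Prod>i<m. Q - q ^ i) / (\<Prod>i=1..m. q ^ i - 1))
     = (-1) ^ n * R / P + (-1) ^ Suc n * ((Q - 1) * R) / (P * (q ^ Suc n - 1))"
    unfolding sum.atMost_Suc Suc shift P by (simp add: P_def R_def)
  also have "\<dots> = (-1) ^ Suc n * (R * (Q - q ^ Suc n)) / (P * (q ^ Suc n - 1))"
    using nz by (simp add: field_simps)
  finally show ?case unfolding P R .
qed

text \<open>
  In the closed form of the sum, the factors run over \<open>q ^ d - q ^ i\<close> with \<open>1 \<le> i \<le> n\<close>, so it
  vanishes for \<open>1 \<le> d \<le> n\<close>. For \<open>d = 0\<close> numerator and denominator agree up to the
  sign \<open>(-1) ^ n\<close>, which cancels.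
\<close>

lemma q_alternating_sum_indicator:
  fixes q :: real
  assumes "q > 1" "d \<le> n"
  shows "(\<Sum>m\<le>n. (-1) ^ m * (\<Prod>i<m. q ^ d - q ^ i) / (\<Prod>i=1..m. q ^ i - 1))
    = (if d = 0 then 1 else 0)"
proof (cases "d = 0")
  case True
  have nz: "q ^ i - 1 \<noteq> 0" if "1 \<le> i" for i
    using one_less_power[OF assms(1), of i] that by simp
  have "(\<Prod>i=1..n. 1 - q ^ i) = (\<Prod>i=1..n. (-1) * (q ^ i - 1))"
    by (intro prod.cong) auto
  also have "\<dots> = (-1) ^ n * (\<Prod>i=1..n. q ^ i - 1)"
    unfolding prod.distrib by simp
  finally have "(\<Prod>i=1..n. 1 - q ^ i) = (-1) ^ n * (\<Prod>i=1..n. q ^ i - 1)" .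
  moreover have "(\<Prod>i=1..n. q ^ i - 1) \<noteq> 0"
    using nz by (simp add: prod_zero_iff)
  ultimately show ?thesis
    unfolding q_alternating_sum[OF assms(1)] using True by (simp flip: power_mult_distrib)
next
  case False
  then have "(\<Prod>i=1..n. q ^ d - q ^ i) = 0"
    using assms(2) by (intro prod_zero) auto
  then show ?thesis
    unfolding q_alternating_sum[OF assms(1)] using False by simp
qed

text \<open>
  The coefficients of Euler's expansion of the product of all \<open>1 - u / q ^ r\<close> with \<open>r \<ge> 1\<close>.
\<close>

definition euler_coeff :: "real \<Rightarrow> nat \<Rightarrow> real" where
  "euler_coeff q k = (-1) ^ k / (\<Prod>i=1..k. q ^ i - 1)"

theorem card_linear_derangements:
  "real (card {A :: 'a::{field,finite} mat. linear_derangement n A})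
    = real (card (GL_mats n :: 'a mat set)) * (\<Sum>m\<le>n. euler_coeff (real CARD('a)) m)"
proof -
  let ?G = "GL_mats n :: 'a mat set"
  define q where "q = real CARD('a)"
  have q: "q > 1" using two_le_card_field[where 'a='a] by (simp add: q_def)
  have ind: "(\<Sum>m\<le>n. euler_coeff q m * real (card (indep_lists n (fixed_space n A) m)))
    = (if linear_derangement n A then 1 else 0)" if A: "A \<in> ?G" for A
  proof -
    have Ac: "A \<in> carrier_mat n n" using A by (simp add: GL_mats_def)
    note F = is_subspace_fixed_space[OF Ac]
    obtain d where d: "d \<le> n" "card (fixed_space n A) = CARD('a) ^ d"
      using card_subspace[OF F] by metis
    have zero: "0\<^sub>v n \<in> fixed_space n A" using F by (simp add: is_subspace_def)
    have "linear_derangement n A \<longleftrightarrow> fixed_space n A = {0\<^sub>v n}"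
      using A zero by (auto simp: linear_derangement_def GL_mats_def fixed_space_def)
    also have "\<dots> \<longleftrightarrow> card (fixed_space n A) = 1"
      using zero by (auto simp: card_1_singleton_iff)
    also have "\<dots> \<longleftrightarrow> d = 0"
      using d two_le_card_field[where 'a='a] by simp
    finally show ?thesis
      using q_alternating_sum_indicator[OF q d(1)]
      by (simp add: card_indep_lists[OF F] d(2) euler_coeff_def flip: q_def)
  qed
  have "real (card {A :: 'a mat. linear_derangement n A}) = (\<Sum>A\<in>?G. if linear_derangement n A then 1 else 0)"
  proof -
    have "{A \<in> ?G. linear_derangement n A} = {A. linear_derangement n A}"
      by (auto simp: linear_derangement_def GL_mats_def)
    then show ?thesis
      using finite_GL_mats[of n, where 'a='a] by (simp flip: sum.inter_filter)
  qed
  also have "\<dots> = (\<Sum>A\<in>?G. \<Sum>m\<le>n. euler_coeff q m * real (card (indep_lists n (fixed_space n A) m)))"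
    using ind by simp
  also have "\<dots> = (\<Sum>m\<le>n. euler_coeff q m * real (\<Sum>A\<in>?G. card (indep_lists n (fixed_space n A) m)))"
    by (subst sum.swap) (simp add: sum_distrib_left)
  also have "\<dots> = (\<Sum>m\<le>n. euler_coeff q m * real (card ?G))"
    by (intro sum.cong) (simp_all only: sum_fixed_indep_lists atMost_iff)
  finally show ?thesis by (simp add: q_def sum_distrib_left mult.commute)
qed

section \<open>Euler's product\<close>

text \<open>
  Coefficientwise, this is the functional equation \<open>P (Suc N) (q u) = (1 - u) * P N u\<close>: replacing \<open>u\<close>
  by \<open>q u\<close> turns the factor \<open>1 - x ^ r * u\<close> into its predecessor \<open>1 - x ^ (r - 1) * u\<close>.
\<close>

lemma finite_euler_prod_functional:
  fixes x q :: real and N :: nat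
  defines "P \<equiv> \<lambda>N. \<Prod>r=1..N. 1 - fps_const (x ^ r) * fps_X :: real fps"
  assumes xq: "x * q = 1"
  shows "q ^ Suc k * fps_nth (P (Suc N)) (Suc k) = fps_nth (P N) (Suc k) - fps_nth (P N) k"
proof -
  have rec: "fps_nth (P (Suc N)) (Suc j) = fps_nth (P N) (Suc j) - x ^ Suc N * fps_nth (P N) j" for N j
    by (simp add: P_def algebra_simps del: power_Suc)
  have rec0: "fps_nth (P N) 0 = 1" for N
    by (induction N) (simp_all add: P_def algebra_simps)
  show ?thesis
  proof (induction N arbitrary: k)
    case 0
    have "q ^ Suc k * (x * fps_nth 1 k) = fps_nth 1 k"
      using xq by (cases k) (auto simp: mult.commute)
    then show ?case using rec[of 0 k] by (simp add: P_def)
  next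
    case (Suc N)
    note IH = Suc.IH
    have x: "q * x ^ Suc (Suc N) = x ^ Suc N" using xq by (simp add: algebra_simps)
    show ?case
    proof (cases k)
      case 0
      have "q ^ Suc k * fps_nth (P (Suc (Suc N))) (Suc k)
        = q ^ Suc k * fps_nth (P (Suc N)) (Suc k) - q * x ^ Suc (Suc N)"
        using 0 by (simp add: rec[of "Suc N"] rec0 algebra_simps del: power_Suc)
      then show ?thesis using 0 IH[of 0] x by (simp add: rec[of N] rec0 del: power_Suc)
    next
      case (Suc j)
      have "q ^ Suc k * fps_nth (P (Suc (Suc N))) (Suc k)
        = q ^ Suc k * fps_nth (P (Suc N)) (Suc k) - (q * x ^ Suc (Suc N)) * (q ^ Suc j * fps_nth (P (Suc N)) (Suc j))"
        using Suc by (subst rec[of "Suc N"]) (simp add: algebra_simps)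
      also have "\<dots> = fps_nth (P (Suc N)) (Suc k) - fps_nth (P (Suc N)) k"
        unfolding x IH by (simp add: Suc rec[of N] right_diff_distrib del: power_Suc)
      finally show ?thesis .
    qed
  qed
qed

text \<open>
  Eliminating the coefficient of \<open>u ^ Suc k\<close> in \<open>P N\<close> between the functional equation and the
  recursion \<open>P (Suc N) u = (1 - u / q ^ Suc N) * P N u\<close> leaves a formula for the coefficient of
  \<open>u ^ Suc k\<close> in \<open>P (Suc N)\<close> in terms of that of \<open>u ^ k\<close> in \<open>P N\<close>. Its limit is the recursion of
  \<open>euler_coeff\<close>.
\<close>

lemma euler_prod_coeff_tendsto:
  fixes q :: real
  assumes "q > 1"
  shows "(\<lambda>N. fps_nth (\<Prod>r=1..N. 1 - fps_const (1 / q ^ r) * fps_X) k) \<longlonglongrightarrow> euler_coeff q k"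
proof (induction k)
  case 0
  have "fps_nth (\<Prod>r=1..N. 1 - fps_const (1 / q ^ r) * fps_X) 0 = 1" for N
    by (induction N) simp_all
  then show ?case by (simp add: euler_coeff_def)
next
  case (Suc k)
  define P where "P = (\<lambda>N. \<Prod>r=1..N. 1 - fps_const (1 / q ^ r) * fps_X :: real fps)"
  have P_alt: "P = (\<lambda>N. \<Prod>r=1..N. 1 - fps_const ((1 / q) ^ r) * fps_X)"
    by (simp add: P_def power_divide)
  have nz: "q ^ Suc k - 1 \<noteq> 0"
    using one_less_power[OF assms, of "Suc k"] by simp
  have rec: "fps_nth (P (Suc N)) (Suc k) = - (1 - (1 / q) ^ Suc N) * fps_nth (P N) k / (q ^ Suc k - 1)" for N
  proof -
    have "fps_nth (P (Suc N)) (Suc k) = fps_nth (P N) (Suc k) - (1 / q) ^ Suc N * fps_nth (P N) k"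
      by (simp add: P_alt algebra_simps del: power_Suc)
    moreover have "q ^ Suc k * fps_nth (P (Suc N)) (Suc k) = fps_nth (P N) (Suc k) - fps_nth (P N) k"
      unfolding P_alt using assms by (intro finite_euler_prod_functional) simp
    ultimately have "(q ^ Suc k - 1) * fps_nth (P (Suc N)) (Suc k) = - (1 - (1 / q) ^ Suc N) * fps_nth (P N) k"
      by (simp add: algebra_simps del: power_Suc)
    then show ?thesis using nz by (simp add: field_simps del: power_Suc)
  qed
  have "(\<lambda>N. (1 / q) ^ Suc N) \<longlonglongrightarrow> 0"
    using assms by (intro LIMSEQ_Suc LIMSEQ_power_zero) auto
  then have "(\<lambda>N. fps_nth (P (Suc N)) (Suc k)) \<longlonglongrightarrow> - (1 - 0) * euler_coeff q k / (q ^ Suc k - 1)"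
    unfolding rec using Suc nz by (intro tendsto_intros) (auto simp: P_def)
  also have "- (1 - 0) * euler_coeff q k / (q ^ Suc k - 1) = euler_coeff q (Suc k)"
    by (simp add: euler_coeff_def)
  finally show ?case unfolding P_def by (rule LIMSEQ_imp_Suc)
qed

theorem theorem8:
  fixes q :: nat and e \<gamma> :: "nat \<Rightarrow> nat"
  assumes "q = CARD('a :: {field, finite})"
    and "\<And>n. \<gamma> n = card (GL_mats n :: 'a mat set)"
    and "\<And>n. n \<ge> 1 \<Longrightarrow> e n = card {A :: 'a mat. linear_derangement n A}"
  shows "fps_convergent_prod (\<lambda>r. 1 - fps_const (1 / real q ^ r) * fps_X) \<and>
    1 + Abs_fps (\<lambda>n. if n \<ge> 1 then real (e n) / real (\<gamma> n) else 0) =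
      1 / (1 - fps_X) * fps_prodinf (\<lambda>r. 1 - fps_const (1 / real q ^ r) * fps_X)"
proof
  let ?f = "\<lambda>r. 1 - fps_const (1 / real q ^ r) * fps_X :: real fps"
  have q: "real q > 1" using two_le_card_field[where 'a='a] assms(1) by simp
  note lim = euler_prod_coeff_tendsto[OF q]
  show "fps_convergent_prod ?f"
    unfolding fps_convergent_prod_def using lim convergentI by blast
  have prodinf: "fps_prodinf ?f = Abs_fps (euler_coeff (real q))"
    unfolding fps_prodinf_def using limI[OF lim] by simp
  have "\<gamma> n > 0" for n
    unfolding assms(2) using finite_GL_mats GL_matsI[of "1\<^sub>m n" n "1\<^sub>m n"]
    by (auto simp: card_gt_0_iff)
  then have ratio: "real (e n) / real (\<gamma> n) = (\<Sum>m\<le>n. euler_coeff (real q) m)" if "n \<ge> 1" for n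
    using card_linear_derangements[where 'a='a, of n] assms that
    by (simp add: field_simps) 
  have "1 / (1 - fps_X) * fps_prodinf ?f = fps_prodinf ?f / (1 - fps_X)"
    by (simp add: fps_divide_unit)
  also have "\<dots> = Abs_fps (\<lambda>n. \<Sum>m\<le>n. euler_coeff (real q) m)"
    unfolding prodinf fps_divide_fps_X_minus1_sum by (simp add: atLeast0AtMost)
  also have "\<dots> = 1 + Abs_fps (\<lambda>n. if n \<ge> 1 then real (e n) / real (\<gamma> n) else 0)"
  proof (rule fps_ext)
    fix n
    show "fps_nth (Abs_fps (\<lambda>n. \<Sum>m\<le>n. euler_coeff (real q) m)) n
        = fps_nth (1 + Abs_fps (\<lambda>n. if n \<ge> 1 then real (e n) / real (\<gamma> n) else 0)) n"
      by (cases "n = 0") (simp_all add: ratio euler_coeff_def)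
  qed
  finally show "1 + Abs_fps (\<lambda>n. if n \<ge> 1 then real (e n) / real (\<gamma> n) else 0)
      = 1 / (1 - fps_X) * fps_prodinf ?f" ..
qed

end
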